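(* Let $V$ be a finite set, $f\colon 2^V\to\mathbb{R}_{\ge 0}$ a submodular function with $f(\emptyset)=0$, and $\mathcal{M}$ a matroid on $V$ of rank $k\ge 1$. The partition $\mathcal{P}_k$ returned by the greedy splitting algorithm on $(f,\mathcal{M})$ (described in the context) is feasible and satisfies $f(\mathcal{P}_k)\le (k-1)\,\mathrm{OPT}$, where $\mathrm{OPT}$ is the optimum value of the Submodular Matroid-constrained Partitioning problem for $(f,\mathcal{M})$.
   Context: $f$ is submodular if $f(A)+f(B)\ge f(A\cup B)+f(A\cap B)$ for all $A,B\subseteq V$. For a partition $\mathcal{P}$ of $V$, $f(\mathcal{P})=\sum_{X\in\mathcal{P}}f(X)$. Submodular Matroid-constrained Partitioning: given $f$ and a rank-$k$ matroid $\mathcal{M}=(V,\mathcal{I})$ with bases $\mathcal{B}$, a partition $\{V_1,\dots,V_k\}$ of $V$ is feasible if some $B\in\mathcal{B}$ has $|B\cap V_i|=1$ for all $i$; minimize $f(\mathcal{P})$ over feasible $\mathcal{P}$; $\mathrm{OPT}$ denotes the minimum. A transversal of a partition is a set containing exactly one element of each class. Greedy splitting algorithm: set $\mathcal{P}_1=\{V\}$. For $i=1,\dots,k-1$: among all pairs $(X,W)$ with $W\in\mathcal{P}_i$, $X\subseteq W$, such that some $I\in\mathcal{I}$ is a transversal of $(\mathcal{P}_i\setminus\{W\})\cup\{X,W\setminus X\}$, choose one minimizing $f(X)+f(W\setminus X)-f(W)$, and set $\mathcal{P}_{i+1}=(\mathcal{P}_i\setminus\{W\})\cup\{X,W\setminus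 X\}$. Return $\mathcal{P}_k$.
   Formalization: The bound f(P_k) ≤ (k−1)OPT is claimed only for k ≥ 2, since for k = 1 it would say f(V) ≤ 0, which fails e.g. for V={a}, f({a})=1; feasibility is proved for all k ≥ 1. *)

theory Defs
  imports Complex_Main "HOL-Library.Disjoint_Sets"
begin

definition submodular_on :: "'a set \<Rightarrow> ('a set \<Rightarrow> real) \<Rightarrow> bool" where
  "submodular_on V f \<longleftrightarrow>
     (\<forall>A B. A \<subseteq> V \<longrightarrow> B \<subseteq> V \<longrightarrow> f A + f B \<ge> f (A \<union> B) + f (A \<inter> B))"

locale matroid =
  fixes V :: "'a set" and \<I> :: "'a set set"
  assumes finite_ground: "finite V"
    and indep_subset_ground: "I \<in> \<I> \<Longrightarrow> I \<subseteq> V"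
    and indep_empty: "{} \<in> \<I>"
    and indep_mono: "I \<in> \<I> \<Longrightarrow> J \<subseteq> I \<Longrightarrow> J \<in> \<I>"
    and indep_augment:
      "I \<in> \<I> \<Longrightarrow> J \<in> \<I> \<Longrightarrow> card I < card J \<Longrightarrow> \<exists>x\<in>J - I. insert x I \<in> \<I>"

definition matroid_bases :: "'a set set \<Rightarrow> 'a set set" where
  "matroid_bases \<I> = {B \<in> \<I>. \<forall>I\<in>\<I>. B \<subseteq> I \<longrightarrow> I = B}"

definition matroid_rank :: "'a set set \<Rightarrow> nat" where
  "matroid_rank \<I> = Max (card ` \<I>)"

definition partition_value :: "('a set \<Rightarrow> real) \<Rightarrow> 'a set set \<Rightarrow> real" where
  "partition_value f P = (\<Sum>X\<in>P. f X)"

definition transversal :: "'a set \<Rightarrow> 'a set set \<Rightarrow> bool" where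
  "transversal T P \<longleftrightarrow> (\<forall>X\<in>P. card (T \<inter> X) = 1)"

definition feasible_partition :: "'a set \<Rightarrow> 'a set set \<Rightarrow> 'a set set \<Rightarrow> bool" where
  "feasible_partition V \<I> P \<longleftrightarrow>
     partition_on V P \<and> card P = matroid_rank \<I> \<and>
     (\<exists>B\<in>matroid_bases \<I>. \<forall>X\<in>P. card (B \<inter> X) = 1)"

definition opt_value :: "'a set \<Rightarrow> ('a set \<Rightarrow> real) \<Rightarrow> 'a set set \<Rightarrow> real" where
  "opt_value V f \<I> = Min (partition_value f ` {P. feasible_partition V \<I> P})"

definition split_class :: "'a set set \<Rightarrow> 'a set \<Rightarrow> 'a set \<Rightarrow> 'a set set" where
  "split_class P X W = (P - {W}) \<union> {X, W - X}"

text \<open>Trivial splits with \<open>X = {}\<close> or \<open>X = W\<close> need no separate exclusion: they create an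
  empty class, so no transversal exists.\<close>

definition admissible_split :: "'a set set \<Rightarrow> 'a set set \<Rightarrow> 'a set \<Rightarrow> 'a set \<Rightarrow> bool" where
  "admissible_split \<I> P X W \<longleftrightarrow>
     W \<in> P \<and> X \<subseteq> W \<and> (\<exists>I\<in>\<I>. transversal I (split_class P X W))"

text \<open>Ties in the minimisation may be broken arbitrarily, so the algorithm is a relation:
  \<open>greedy_splitting V f \<I> i P\<close> says that some run has \<open>P\<close> as its \<open>i\<close>-th partition.\<close>

inductive greedy_splitting ::
    "'a set \<Rightarrow> ('a set \<Rightarrow> real) \<Rightarrow> 'a set set \<Rightarrow> nat \<Rightarrow> 'a set set \<Rightarrow> bool"
  for V :: "'a set" and f :: "'a set \<Rightarrow> real" and \<I> :: "'a set set" where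
  start: "greedy_splitting V f \<I> 1 {V}"
| step: "greedy_splitting V f \<I> i P \<Longrightarrow>
     is_arg_min (\<lambda>(X, W). f X + f (W - X) - f W)
       (\<lambda>(X, W). admissible_split \<I> P X W) (X, W) \<Longrightarrow>
     greedy_splitting V f \<I> (Suc i) (split_class P X W)"

end

theory Submission
  imports Defs
begin

text \<open>
  Let \<open>Q\<close> be an optimal partition and \<open>B\<close> a base meeting each class of \<open>Q\<close> once. As long as the
  current partition \<open>P\<close> has fewer than \<open>k\<close> classes, some class \<open>W\<close> of \<open>P\<close> can be split
  admissibly along some \<open>A \<in> Q\<close>: take an independent transversal \<open>I\<close> of \<open>P\<close> with \<open>card (I \<inter> B)\<close>
  maximal and augment it by some \<open>b \<in> B\<close>. By submodularity such a split costs at most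
  \<open>f A + f (V - A) - f V \<le> OPT - f V\<close>, so the \<open>k - 1\<close> greedy steps give
  \<open>f V + (k - 1) (OPT - f V) \<le> (k - 1) OPT\<close> when \<open>k \<ge> 2\<close>.
\<close>

section \<open>Submodular bounds for cutting and merging sets\<close>

text \<open>Submodularity is used for \<open>W\<close>, \<open>A\<close> and then for
  \<open>W \<union> A\<close>, \<open>V - A\<close>. The second pair has union \<open>V\<close> and
  intersection \<open>W - A\<close>, and \<open>f (W \<union> A)\<close> cancels in the sum.\<close>

lemma submodular_split_increase_le:
  assumes "submodular_on V f" "W \<subseteq> V" "A \<subseteq> V"
  shows "f (W \<inter> A) + f (W - A) - f W \<le> f A + f (V - A) - f V"
proof -
  have "f W + f A \<ge> f (W \<union> A) + f (W \<inter> A)"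
    using assms unfolding submodular_on_def by blast
  moreover have "f (W \<union> A) + f (V - A) \<ge> f ((W \<union> A) \<union> (V - A)) + f ((W \<union> A) \<inter> (V - A))"
    using assms unfolding submodular_on_def by (meson Diff_subset Un_least)
  moreover have "(W \<union> A) \<union> (V - A) = V" "(W \<union> A) \<inter> (V - A) = W - A"
    using assms by auto
  ultimately show ?thesis by simp
qed

text \<open>Submodularity adjoins one set at a time; nonnegativity drops the intersection
  term.\<close>

lemma submodular_Union_le_sum:
  assumes "submodular_on V f" "\<And>A. A \<subseteq> V \<Longrightarrow> f A \<ge> 0" "f {} = 0" "finite Q" "\<Union>Q \<subseteq> V"
  shows "f (\<Union>Q) \<le> (\<Sum>X\<in>Q. f X)"
  using assms(4,5)
proof (induction Q rule: finite_induct)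
  case empty
  then show ?case using assms(3) by simp
next
  case (insert X Q)
  have "f X + f (\<Union>Q) \<ge> f (X \<union> \<Union>Q) + f (X \<inter> \<Union>Q)"
    using assms(1) insert.prems unfolding submodular_on_def by simp
  moreover have "f (X \<inter> \<Union>Q) \<ge> 0"
    using insert.prems by (intro assms(2)) auto
  ultimately show ?case using insert by simp
qed

text \<open>Merging all classes other than \<open>A\<close> into the one set \<open>V - A\<close>
  cannot raise the value, by subadditivity.\<close>

lemma partition_on_class_cut_le:
  assumes "submodular_on V f" "\<And>A. A \<subseteq> V \<Longrightarrow> f A \<ge> 0" "f {} = 0" "finite V"
    and Q: "partition_on V Q" "A \<in> Q"
  shows "f A + f (V - A) \<le> partition_value f Q"
proof -
  have fin: "finite Q" using Q(1) assms(4) finite_elements by blast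
  have "V - A = \<Union>(Q - {A})"
    using Q partition_onD1[OF Q(1)] partition_onD2[OF Q(1)] unfolding disjoint_def by blast
  moreover have "f (\<Union>(Q - {A})) \<le> (\<Sum>X\<in>Q - {A}. f X)"
    using partition_onD1[OF Q(1)] fin by (intro submodular_Union_le_sum[OF assms(1-3)]) auto
  ultimately show ?thesis
    unfolding partition_value_def using fin Q(2) by (simp add: sum.remove)
qed

section \<open>Partitions, transversals and class splits\<close>

text \<open>The classes cut \<open>T\<close> into disjoint singletons. Hence an independent
  transversal of \<open>matroid_rank \<I>\<close> classes is a base.\<close>

lemma card_eq_of_transversal:
  assumes "partition_on V P" "finite V" "T \<subseteq> V" "transversal T P"
  shows "card T = card P"
proof -
  have "T = (\<Union>X\<in>P. T \<inter> X)" using assms(3) partition_onD1[OF assms(1)] by auto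
  also have "card \<dots> = (\<Sum>X\<in>P. card (T \<inter> X))"
    using assms finite_elements[OF assms(2,1)] partition_onD2[OF assms(1)]
    by (intro card_UN_disjoint) (auto simp: disjoint_def intro: finite_subset)
  also have "\<dots> = card P" using assms(4) by (simp add: transversal_def)
  finally show ?thesis .
qed

lemma finite_partitions_on: "finite V \<Longrightarrow> finite {P. partition_on V P}"
  by (rule finite_subset[of _ "Pow (Pow V)"]) (auto simp: partition_on_def)

lemma admissible_split_proper:
  assumes "admissible_split \<I> P X W"
  shows "W \<in> P" "X \<subseteq> W" "X \<noteq> {}" "W - X \<noteq> {}"
  using assms unfolding admissible_split_def transversal_def split_class_def by auto

lemma
  assumes P: "partition_on V P" and fin: "finite V" and adm: "admissible_split \<I> P X W"
  shows partition_on_split_class: "partition_on V (split_class P X W)"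
    and card_split_class: "card (split_class P X W) = Suc (card P)"
    and partition_value_split_class:
      "partition_value f (split_class P X W) = partition_value f P + (f X + f (W - X) - f W)"
proof -
  note pr = admissible_split_proper[OF adm]
  have disj: "Y \<inter> Z = {}" if "Y \<in> P" "Z \<in> P" "Y \<noteq> Z" for Y Z
    using partition_onD2[OF P] that by (auto simp: disjoint_def)
  have finP: "finite P" using finite_elements[OF fin P] .
  have sub: "Y \<inter> Z = {}" if "Y \<in> P - {W}" "Z \<subseteq> W" for Y Z
    using disj[of Y W] that pr(1) by blast
  \<comment> \<open>Equal classes would collapse in a set of sets. Both parts must be new and
    distinct for the class count and the sum over classes to come out right.\<close>
  have nX: "X \<notin> P - {W}" using sub[of X X] pr(2,3) by blast
  have nD: "W - X \<notin> P - {W}" using sub[of "W - X" "W - X"] pr(4) by blast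
  have ne: "X \<noteq> W - X" using pr(3) by blast
  show "partition_on V (split_class P X W)"
  proof (rule partition_onI)
    show "\<Union>(split_class P X W) = V"
      using pr partition_onD1[OF P] unfolding split_class_def by auto
    show "disjnt Y Z" if "Y \<in> split_class P X W" "Z \<in> split_class P X W" "Y \<noteq> Z" for Y Z
    proof -
      have "X \<inter> (W - X) = {}" "(W - X) \<inter> X = {}" by auto
      then have "Y \<inter> Z = {}"
        using that sub[of Y Z] sub[of Z Y] disj[of Y Z] pr(2) unfolding split_class_def by auto
      then show ?thesis by (simp add: disjnt_def)
    qed
    show "{} \<notin> split_class P X W"
      using pr partition_onD3[OF P] unfolding split_class_def by auto
  qed
  have eq: "split_class P X W = insert X (insert (W - X) (P - {W}))"
    unfolding split_class_def by auto
  \<comment> \<open>Removing \<open>W\<close> leaves \<open>card P - 1\<close> classes in truncated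
    subtraction, so positivity is what makes the count after adding two parts equal
    \<open>Suc (card P)\<close>.\<close>
  have "card P > 0" using finP pr(1) card_gt_0_iff by blast
  then show "card (split_class P X W) = Suc (card P)"
    unfolding eq using finP nX nD ne pr(1) by (simp add: card_insert_if card_Diff_singleton)
  show "partition_value f (split_class P X W) = partition_value f P + (f X + f (W - X) - f W)"
    unfolding eq partition_value_def using finP nX nD ne pr(1)
    by (simp add: sum.insert_if sum_diff1)
qed

lemma finite_admissible_splits:
  assumes "partition_on V P" "finite V"
  shows "finite {(X, W). admissible_split \<I> P X W}"
proof (rule finite_subset)
  show "{(X, W). admissible_split \<I> P X W} \<subseteq> Pow V \<times> Pow V"
    using partition_onD1[OF assms(1)] by (auto simp: admissible_split_def)
qed (use assms in simp)

section \<open>Bases and rank of a matroid\<close>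

context matroid
begin

lemma finite_indep: "finite \<I>"
  by (rule finite_subset[of _ "Pow V"]) (auto simp: finite_ground dest: indep_subset_ground)

lemma finite_indep_set: "I \<in> \<I> \<Longrightarrow> finite I"
  using indep_subset_ground finite_ground finite_subset by blast

lemma card_indep_le_rank: "I \<in> \<I> \<Longrightarrow> card I \<le> matroid_rank \<I>"
  unfolding matroid_rank_def using finite_indep by simp

lemma obtain_base: obtains B where "B \<in> \<I>" "card B = matroid_rank \<I>"
proof -
  have "matroid_rank \<I> \<in> card ` \<I>"
    unfolding matroid_rank_def using finite_indep indep_empty by (intro Max_in) auto
  then show ?thesis using that by auto
qed

text \<open>A maximal independent set of smaller size could be augmented from one of rank size;
  conversely, a set of maximum cardinality has no proper independent superset.\<close>

lemma matroid_bases_iff: "B \<in> matroid_bases \<I> \<longleftrightarrow> B \<in> \<I> \<and> card B = matroid_rank \<I>"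
proof
  assume B: "B \<in> matroid_bases \<I>"
  obtain J where J: "J \<in> \<I>" "card J = matroid_rank \<I>" using obtain_base .
  have "\<not> card B < card J"
    using B J(1) indep_augment[of B J] unfolding matroid_bases_def by blast
  then show "B \<in> \<I> \<and> card B = matroid_rank \<I>"
    using B J card_indep_le_rank[of B] unfolding matroid_bases_def by auto
next
  assume B: "B \<in> \<I> \<and> card B = matroid_rank \<I>"
  have "I = B" if "I \<in> \<I>" "B \<subseteq> I" for I
    using card_seteq[OF finite_indep_set[OF that(1)] that(2)] card_indep_le_rank[OF that(1)] B
    by simp
  then show "B \<in> matroid_bases \<I>" using B by (simp add: matroid_bases_def)
qed

lemma feasible_partitionI:
  assumes "partition_on V P" "card P = matroid_rank \<I>" "I \<in> \<I>" "transversal I P"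
  shows "feasible_partition V \<I> P"
proof -
  have "I \<in> matroid_bases \<I>"
    using assms card_eq_of_transversal[OF assms(1) finite_ground indep_subset_ground]
    by (simp add: matroid_bases_iff)
  then show ?thesis
    using assms unfolding feasible_partition_def transversal_def by blast
qed

section \<open>Existence of admissible splits by exchange\<close>

text \<open>The cut separates the two elements: \<open>b\<close> represents
  \<open>W \<inter> A\<close>, and the old representative \<open>w\<close> stays in
  \<open>W - A\<close>.\<close>

lemma transversal_insert_split:
  assumes P: "partition_on V P" and I: "transversal I P"
    and W: "W \<in> P" "I \<inter> W = {w}" and b: "b \<in> W" "b \<in> A" "w \<notin> A"
  shows "transversal (insert b I) (split_class P (W \<inter> A) W)"
  unfolding transversal_def
proof
  fix Y assume "Y \<in> split_class P (W \<inter> A) W"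
  then consider "Y \<in> P" "Y \<noteq> W" | "Y = W \<inter> A" | "Y = W - A"
    unfolding split_class_def by blast
  then show "card (insert b I \<inter> Y) = 1"
  proof cases
    case 1
    then have "b \<notin> Y"
      using partition_onD2[OF P] W(1) b(1) by (auto simp: disjoint_def)
    then show ?thesis using I 1 by (simp add: transversal_def)
  next
    case 2
    then have "insert b I \<inter> Y = {b}" using W(2) b by auto
    then show ?thesis by simp
  next
    case 3
    then have "insert b I \<inter> Y = {w}" using W(2) b by auto
    then show ?thesis by simp
  qed
qed

text \<open>Only the representative of \<open>W\<close> changes, since the other classes are
  disjoint from \<open>W\<close>.\<close>

lemma transversal_exchange:
  assumes P: "partition_on V P" and I: "transversal I P"
    and W: "W \<in> P" "I \<inter> W = {w}" and b: "b \<in> W"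
  shows "transversal (insert b (I - {w})) P"
  unfolding transversal_def
proof
  fix Y assume Y: "Y \<in> P"
  show "card (insert b (I - {w}) \<inter> Y) = 1"
  proof (cases "Y = W")
    case True
    then have "insert b (I - {w}) \<inter> Y = {b}" using W b by auto
    then show ?thesis by simp
  next
    case False
    then have "W \<inter> Y = {}" using partition_onD2[OF P] W(1) Y by (auto simp: disjoint_def)
    then have "insert b (I - {w}) \<inter> Y = I \<inter> Y" using W b by blast
    then show ?thesis using I Y by (simp add: transversal_def)
  qed
qed

text \<open>This supplies the competitor for the greedy choice: a class of any feasible
  \<open>Q\<close> can serve as the cutting set while \<open>P\<close> has too few classes.\<close>

lemma exists_admissible_split:
  assumes P: "partition_on V P" "card P < matroid_rank \<I>" "I \<in> \<I>" "transversal I P"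
    and Q: "feasible_partition V \<I> Q"
  obtains W A where "W \<in> P" "A \<in> Q" "admissible_split \<I> P (W \<inter> A) W"
proof -
  obtain B where B: "B \<in> \<I>" "card B = matroid_rank \<I>" and BQ: "\<And>A. A \<in> Q \<Longrightarrow> card (B \<inter> A) = 1"
    and partQ: "partition_on V Q"
    using Q matroid_bases_iff unfolding feasible_partition_def by blast
  let ?S = "{J \<in> \<I>. transversal J P}"
  have "finite ?S" "?S \<noteq> {}" using finite_indep P(3,4) by auto
  then obtain J where J: "J \<in> ?S" and Jmax: "\<And>K. K \<in> ?S \<Longrightarrow> card (K \<inter> B) \<le> card (J \<inter> B)"
    using ex_is_arg_min_if_finite[of ?S "\<lambda>K. - int (card (K \<inter> B))"]
    by (auto simp: is_arg_min_linorder)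
  have "card J < card B"
    using J P(1,2) B card_eq_of_transversal[OF P(1) finite_ground] indep_subset_ground by simp
  then obtain b where b: "b \<in> B" "b \<notin> J" "insert b J \<in> \<I>"
    using indep_augment[of J B] J B by blast
  then have "b \<in> V" using B indep_subset_ground by blast
  then obtain W A where W: "W \<in> P" "b \<in> W" and A: "A \<in> Q" "b \<in> A"
    using partition_onD1[OF P(1)] partition_onD1[OF partQ] by blast
  obtain w where w: "J \<inter> W = {w}"
    using J W(1) unfolding transversal_def by (auto simp: card_1_singleton_iff)
  \<comment> \<open>If \<open>w\<close> lay in \<open>A\<close>, the cut would not separate it from
    \<open>b\<close>. But if \<open>w \<in> B\<close>, then \<open>B\<close> meets \<open>A\<close>
    twice; if \<open>w \<notin> B\<close>, trading \<open>w\<close> for \<open>b\<close> gives an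
    independent transversal with more elements of \<open>B\<close>, against the choice of
    \<open>J\<close>.\<close>
  have "w \<notin> A"
  proof
    assume wA: "w \<in> A"
    have "w \<noteq> b" using w b(2) by blast
    show False
    proof (cases "w \<in> B")
      case True
      then have "{w, b} \<subseteq> B \<inter> A" using wA b A by blast
      then have "card {w, b} \<le> card (B \<inter> A)"
        using finite_indep_set[OF B(1)] by (intro card_mono) simp_all
      then show False using BQ[OF A(1)] \<open>w \<noteq> b\<close> by simp
    next
      case False
      have "insert b (J - {w}) \<in> \<I>"
        by (rule indep_mono[OF b(3)]) auto
      moreover have "transversal (insert b (J - {w})) P"
        using J by (intro transversal_exchange[OF P(1) _ W(1) w W(2)]) simp
      ultimately have "card (insert b (J - {w}) \<inter> B) \<le> card (J \<inter> B)"
        by (intro Jmax) simp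
      moreover have "insert b (J - {w}) \<inter> B = insert b (J \<inter> B)" using False b by auto
      moreover have "finite (J \<inter> B)" using finite_indep_set[of J] J by simp
      ultimately show False using b(2) by simp
    qed
  qed
  then have "transversal (insert b J) (split_class P (W \<inter> A) W)"
    using J by (intro transversal_insert_split[OF P(1) _ W(1) w W(2) A(2)]) auto
  then have "admissible_split \<I> P (W \<inter> A) W"
    unfolding admissible_split_def using W(1) b(3) by auto
  then show ?thesis using that W(1) A(1) by blast
qed

section \<open>A feasible partition and the initial transversal\<close>

text \<open>All elements of a base but one become singleton classes; the last one, \<open>b\<close>,
  shares its class with the rest of \<open>V\<close>.\<close>

lemma exists_feasible_partition:
  assumes "matroid_rank \<I> \<ge> 1"
  obtains Q where "feasible_partition V \<I> Q"
proof -
  obtain B where B: "B \<in> \<I>" "card B = matroid_rank \<I>" using obtain_base by blast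
  then obtain b where b: "b \<in> B" using assms by fastforce
  have BV: "B \<subseteq> V" using B indep_subset_ground by blast
  let ?R = "V - (B - {b})"
  let ?S = "(\<lambda>x. {x}) ` (B - {b})"
  let ?Q = "insert ?R ?S"
  have part: "partition_on V ?Q"
    using b BV by (intro partition_onI) (auto simp: disjnt_def)
  have trans: "transversal B ?Q"
    unfolding transversal_def
  proof
    fix Y assume "Y \<in> ?Q"
    then have "B \<inter> Y = {b} \<or> (\<exists>x. B \<inter> Y = {x})" using b BV by auto
    then show "card (B \<inter> Y) = 1" by auto
  qed
  have "card ?Q = matroid_rank \<I>"
    using card_eq_of_transversal[OF part finite_ground BV trans] B by simp
  then show ?thesis using that feasible_partitionI part B(1) trans by blast
qed

lemma exists_indep_transversal_ground:
  assumes "matroid_rank \<I> \<ge> 1"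
  obtains I where "I \<in> \<I>" "transversal I {V}"
proof -
  obtain B where B: "B \<in> \<I>" "card B = matroid_rank \<I>" using obtain_base by blast
  then obtain b where b: "b \<in> B" using assms by fastforce
  then have "{b} \<in> \<I>" "{b} \<inter> V = {b}"
    using indep_mono[OF B(1)] indep_subset_ground[OF B(1)] by auto
  then show ?thesis using that[of "{b}"] by (simp add: transversal_def)
qed

section \<open>Runs of the greedy algorithm\<close>

text \<open>Admissibility itself provides the independent transversal of the next partition. At
  \<open>i = matroid_rank \<I>\<close> the invariant amounts to feasibility.\<close>

lemma greedy_splitting_invariant:
  assumes "greedy_splitting V f \<I> i P" "matroid_rank \<I> \<ge> 1"
  shows "partition_on V P \<and> card P = i \<and> (\<exists>I\<in>\<I>. transversal I P)"
  using assms(1)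
proof (induction rule: greedy_splitting.induct)
  case start
  obtain I where I: "I \<in> \<I>" "transversal I {V}"
    using exists_indep_transversal_ground[OF assms(2)] .
  then have "V \<noteq> {}" by (auto simp: transversal_def)
  then show ?case using I by (auto simp: partition_on_def)
next
  case (step i P X W)
  then have adm: "admissible_split \<I> P X W" by (simp add: is_arg_min_def)
  then show ?case
    using step.IH partition_on_split_class[OF _ finite_ground adm]
      card_split_class[OF _ finite_ground adm]
    unfolding admissible_split_def by auto
qed

text \<open>The algorithm never gets stuck: below the rank some split is admissible, and finiteness
  of the candidates yields a minimizer.\<close>

lemma exists_greedy_splitting:
  assumes "1 \<le> i" "i \<le> matroid_rank \<I>"
  shows "\<exists>P. greedy_splitting V f \<I> i P"
  using assms
proof (induction i rule: dec_induct)
  case base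
  then show ?case using greedy_splitting.start by blast
next
  case (step i)
  then obtain P where P: "greedy_splitting V f \<I> i P" by auto
  have "matroid_rank \<I> \<ge> 1" using step by simp
  note inv = greedy_splitting_invariant[OF P this]
  obtain Q where "feasible_partition V \<I> Q"
    using exists_feasible_partition[OF \<open>matroid_rank \<I> \<ge> 1\<close>] .
  then obtain X W where "admissible_split \<I> P X W"
    using exists_admissible_split inv step.prems by (metis Suc_le_lessD)
  then have "{(X, W). admissible_split \<I> P X W} \<noteq> {}" by auto
  then have "\<exists>p. is_arg_min (\<lambda>(X, W). f X + f (W - X) - f W)
      (\<lambda>p. p \<in> {(X, W). admissible_split \<I> P X W}) p"
    using inv finite_ground
    by (intro ex_is_arg_min_if_finite finite_admissible_splits[of V]) auto
  then obtain X W where "is_arg_min (\<lambda>(X, W). f X + f (W - X) - f W)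
      (\<lambda>(X, W). admissible_split \<I> P X W) (X, W)"
    by auto
  then show ?case using greedy_splitting.step[OF P] by blast
qed

text \<open>The run starts at \<open>f V\<close> and makes \<open>i - 1\<close> splits, each costing
  at most \<open>partition_value f Q - f V\<close>.\<close>

lemma greedy_splitting_value_le:
  assumes f: "submodular_on V f" "\<And>A. A \<subseteq> V \<Longrightarrow> f A \<ge> 0" "f {} = 0"
    and Q: "feasible_partition V \<I> Q"
    and P: "greedy_splitting V f \<I> i P" and "i \<le> matroid_rank \<I>" "matroid_rank \<I> \<ge> 1"
  shows "partition_value f P \<le> f V + (real i - 1) * (partition_value f Q - f V)"
  using P \<open>i \<le> matroid_rank \<I>\<close>
proof (induction rule: greedy_splitting.induct)
  case start
  then show ?case by (simp add: partition_value_def)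
next
  case (step i P X W)
  note inv = greedy_splitting_invariant[OF step.hyps(1) assms(7)]
  have partQ: "partition_on V Q" using Q by (simp add: feasible_partition_def)
  have adm: "admissible_split \<I> P X W" using step.hyps(2) by (simp add: is_arg_min_def)
  obtain U A where U: "U \<in> P" "A \<in> Q" "admissible_split \<I> P (U \<inter> A) U"
    using exists_admissible_split[OF _ _ _ _ Q] inv step.prems by (metis Suc_le_lessD)
  \<comment> \<open>The greedy minimum is compared with cutting \<open>U\<close> along
    \<open>A\<close>, whose cost is then bounded by that of cutting all of \<open>V\<close> along
    \<open>A\<close>.\<close>
  have "f X + f (W - X) - f W \<le> f (U \<inter> A) + f (U - (U \<inter> A)) - f U"
    using step.hyps(2) U(3) by (force simp: is_arg_min_linorder)
  also have "\<dots> = f (U \<inter> A) + f (U - A) - f U" by (simp add: Diff_Int)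
  also have "\<dots> \<le> f A + f (V - A) - f V"
    using U inv partQ by (intro submodular_split_increase_le[OF f(1)]) (auto simp: partition_on_def)
  also have "\<dots> \<le> partition_value f Q - f V"
    using partition_on_class_cut_le[OF f finite_ground partQ U(2)] by simp
  finally have "partition_value f (split_class P X W)
      \<le> partition_value f P + (partition_value f Q - f V)"
    using partition_value_split_class[OF _ finite_ground adm, of f] inv by simp
  then show ?case using step.IH step.prems by (simp add: algebra_simps)
qed

end

theorem theorem4:
  fixes V :: "'a set" and f :: "'a set \<Rightarrow> real" and \<I> :: "'a set set" and k :: nat
  assumes "finite V"
    and "\<And>A. A \<subseteq> V \<Longrightarrow> f A \<ge> 0"
    and "submodular_on V f"
    and "f {} = 0"
    and "matroid V \<I>"
    and "matroid_rank \<I> = k"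
    and "k \<ge> 1"
  shows "(\<exists>P. greedy_splitting V f \<I> k P) \<and>
    (\<forall>P. greedy_splitting V f \<I> k P \<longrightarrow>
       feasible_partition V \<I> P \<and>
       (k \<ge> 2 \<longrightarrow> partition_value f P \<le> (real k - 1) * opt_value V f \<I>))"
proof (intro conjI allI impI)
  interpret matroid V \<I> by fact
  show "\<exists>P. greedy_splitting V f \<I> k P"
    using exists_greedy_splitting assms(6,7) by simp
  fix P assume P: "greedy_splitting V f \<I> k P"
  show "feasible_partition V \<I> P"
    using greedy_splitting_invariant[OF P] feasible_partitionI assms(6,7) by auto
  assume "k \<ge> 2"
  \<comment> \<open>Finiteness and nonemptiness make the \<open>Min\<close> in
    \<open>opt_value\<close> an attained value.\<close>
  have "finite {P. feasible_partition V \<I> P}"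
    using finite_partitions_on[OF assms(1)]
    by (rule rev_finite_subset) (auto simp: feasible_partition_def)
  moreover have "{P. feasible_partition V \<I> P} \<noteq> {}"
    using exists_feasible_partition assms(6,7) by auto
  ultimately have "opt_value V f \<I> \<in> partition_value f ` {P. feasible_partition V \<I> P}"
    unfolding opt_value_def by (intro Min_in) auto
  then obtain Q where Q: "feasible_partition V \<I> Q" "opt_value V f \<I> = partition_value f Q"
    by auto
  have "partition_value f P \<le> f V + (real k - 1) * (partition_value f Q - f V)"
    using greedy_splitting_value_le[OF assms(3,2,4) Q(1) P] assms(6,7) by simp
  also have "\<dots> = (real k - 1) * opt_value V f \<I> - (real k - 2) * f V"
    by (simp add: Q(2) algebra_simps)
  \<comment> \<open>Here \<open>k \<ge> 2\<close> makes \<open>(real k - 2) * f V\<close>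
    nonnegative. For \<open>k = 1\<close> the preceding expression is \<open>f V\<close>, while the
    right-hand side is 0.\<close>
  also have "\<dots> \<le> (real k - 1) * opt_value V f \<I>"
    using \<open>k \<ge> 2\<close> assms(2)[of V] by simp
  finally show "partition_value f P \<le> (real k - 1) * opt_value V f \<I>" .
qed

end
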